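(* Let $G=(V,w,m)$ be a connected, locally finite weighted graph satisfying the curvature-dimension inequality $CD(K,\infty)$ for some $K>0$, and suppose $\operatorname{Deg}_{\max}<\infty$. Then for all $x_0,y_0\in V$, $$\rho(x_0,y_0)\le\frac{\sqrt{2\operatorname{Deg}(x_0)}+\sqrt{2\operatorname{Deg}(y_0)}}{K}.$$
   Context: A weighted graph $G=(V,w,m)$ consists of a countable set $V$, a symmetric function $w:V\times V\to[0,\infty)$ vanishing on the diagonal (edge weight), and a function $m:V\to(0,\infty)$ (vertex measure). It is locally finite if for every $x\in V$ there are only finitely many $y\in V$ with $w(x,y)>0$. It is connected if any two vertices are joined by a finite path $x_0,\dots,x_k$ with $w(x_{i-1},x_i)>0$ for all $i$. The Laplacian is $\Delta f(x)=\frac1{m(x)}\sum_y w(x,y)(f(y)-f(x))$ for $f:V\to\mathbb R$. Set $\operatorname{Deg}(x)=\frac{1}{m(x)}\sum_y w(x,y)$ and $\operatorname{Deg}_{\max}=\sup_{x\in V}\operatorname{Deg}(x)$. For $f,g:V\to\mathbb R$ define $2\Gamma(f,g)=\Delta(fg)-f\Delta g-g\Delta f$ and $2\Gamma_2(f,g)=\Delta\Gamma(f,g)-\Gamma(f,\Delta g)-\Gamma(g,\Delta f)$, and write $\Gamma f=\Gamma(f,f)$, $\Gamma_2(f)=\Gamma_2(f,f)$. The graph $G$ satisfies $CD(K,\infty)$ if $\Gamma_2(f)\ge K\,\Gamma f$ pointwise on $V$ for all $f:V\to\mathbb R$. The resistance metric is $\rho(x,y)=\sup\{f(y)-f(x):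 f:V\to\mathbb R,\ \|\Gamma f\|_\infty\le1\}$, where $\|\cdot\|_\infty$ is the supremum norm. *)

theory Defs
  imports "HOL-Analysis.Analysis"
begin

(* The vertex set is the whole (countable) type 'v; w is the edge weight, m the vertex measure. *)

definition weighted_graph ::
    "('v::countable \<Rightarrow> 'v \<Rightarrow> real) \<Rightarrow> ('v \<Rightarrow> real) \<Rightarrow> bool" where
  "weighted_graph w m \<longleftrightarrow>
     (\<forall>x y. w x y \<ge> 0) \<and> (\<forall>x y. w x y = w y x) \<and> (\<forall>x. w x x = 0) \<and> (\<forall>x. m x > 0)"

definition locally_finite :: "('v \<Rightarrow> 'v \<Rightarrow> real) \<Rightarrow> bool" where
  "locally_finite w \<longleftrightarrow> (\<forall>x. finite {y. w x y > 0})"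

definition connected_graph :: "('v \<Rightarrow> 'v \<Rightarrow> real) \<Rightarrow> bool" where
  "connected_graph w \<longleftrightarrow> (\<forall>x y. (\<lambda>a b. w a b > 0)\<^sup>*\<^sup>* x y)"

(* On a locally finite graph the sums over all vertices below have only finitely many
   nonzero terms. *)

definition laplacian ::
    "('v \<Rightarrow> 'v \<Rightarrow> real) \<Rightarrow> ('v \<Rightarrow> real) \<Rightarrow> ('v \<Rightarrow> real) \<Rightarrow> 'v \<Rightarrow> real" where
  "laplacian w m f x = (1 / m x) * (\<Sum>\<^sub>\<infinity>y. w x y * (f y - f x))"

definition Deg :: "('v \<Rightarrow> 'v \<Rightarrow> real) \<Rightarrow> ('v \<Rightarrow> real) \<Rightarrow> 'v \<Rightarrow> real" where
  "Deg w m x = (1 / m x) * (\<Sum>\<^sub>\<infinity>y. w x y)"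

definition Deg_max :: "('v \<Rightarrow> 'v \<Rightarrow> real) \<Rightarrow> ('v \<Rightarrow> real) \<Rightarrow> ereal" where
  "Deg_max w m = (SUP x. ereal (Deg w m x))"

definition Gamma ::
    "('v \<Rightarrow> 'v \<Rightarrow> real) \<Rightarrow> ('v \<Rightarrow> real) \<Rightarrow> ('v \<Rightarrow> real) \<Rightarrow> ('v \<Rightarrow> real) \<Rightarrow> 'v \<Rightarrow> real" where
  "Gamma w m f g x =
     (laplacian w m (\<lambda>z. f z * g z) x - f x * laplacian w m g x - g x * laplacian w m f x) / 2"

definition Gamma2 ::
    "('v \<Rightarrow> 'v \<Rightarrow> real) \<Rightarrow> ('v \<Rightarrow> real) \<Rightarrow> ('v \<Rightarrow> real) \<Rightarrow> ('v \<Rightarrow> real) \<Rightarrow> 'v \<Rightarrow> real" where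
  "Gamma2 w m f g x =
     (laplacian w m (Gamma w m f g) x
        - Gamma w m f (laplacian w m g) x - Gamma w m g (laplacian w m f) x) / 2"

(* The curvature-dimension inequality CD(K, \<infinity>). *)
definition CD_infinity ::
    "('v \<Rightarrow> 'v \<Rightarrow> real) \<Rightarrow> ('v \<Rightarrow> real) \<Rightarrow> real \<Rightarrow> bool" where
  "CD_infinity w m K \<longleftrightarrow> (\<forall>f x. Gamma2 w m f f x \<ge> K * Gamma w m f f x)"

(* The supremum norm and the resistance metric take values in the extended reals,
   as neither supremum is finite a priori. *)

definition sup_norm :: "('v \<Rightarrow> real) \<Rightarrow> ereal" where
  "sup_norm f = (SUP x. ereal \<bar>f x\<bar>)"

definition resistance_metric ::
    "('v \<Rightarrow> 'v \<Rightarrow> real) \<Rightarrow> ('v \<Rightarrow> real) \<Rightarrow> 'v \<Rightarrow> 'v \<Rightarrow> ereal" where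
  "resistance_metric w m x y = (SUP f\<in>{f. sup_norm (Gamma w m f f) \<le> 1}. ereal (f y - f x))"

end

theory Submission
  imports Defs
begin

text \<open>The heat semigroup of the usual gradient estimate can be replaced by the explicit Euler
  scheme \<open>f \<mapsto> f + \<epsilon> \<Delta>f\<close>. Since \<open>\<Delta>\<close> is bounded, the second-order error \<open>\<epsilon>\<^sup>2 \<Gamma>(\<Delta>f)\<close> of one step is
  at most \<open>4 D\<^sup>2 \<epsilon>\<^sup>2 \<parallel>\<Gamma>f\<parallel>\<close>, where \<open>D\<close> bounds the degrees, so \<open>CD(K, \<infinity>)\<close> makes \<open>\<parallel>\<Gamma>f\<parallel>\<close>
  contract by the factor \<open>1 - 2\<epsilon>q\<close> with \<open>q = K - 2 D\<^sup>2 \<epsilon>\<close>. As \<open>(\<Delta>f)\<^sup>2 \<le> 2 Deg \<Gamma>f\<close>, the total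
  displacement of the iterates at \<open>x\<close> is at most \<open>sqrt (2 Deg x) / q\<close>, while the iterates become
  constant in the limit because the graph is connected. Finally \<open>\<epsilon> \<rightarrow> 0\<close>.\<close>

section \<open>Finite-sum formulas and pointwise estimates on a locally finite graph\<close>

locale locally_finite_graph =
  fixes w :: "'v::countable \<Rightarrow> 'v \<Rightarrow> real" and m :: "'v \<Rightarrow> real"
  assumes weighted: "weighted_graph w m"
    and loc_finite: "locally_finite w"
begin

definition nbrs :: "'v \<Rightarrow> 'v set" where
  "nbrs x = {y. w x y > 0}"

lemma finite_nbrs [simp]: "finite (nbrs x)"
  using loc_finite by (simp add: nbrs_def locally_finite_def)

lemma w_nonneg [simp]: "w x y \<ge> 0"
  using weighted by (simp add: weighted_graph_def)

lemma m_pos [simp]: "m x > 0"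
  using weighted by (simp add: weighted_graph_def)

lemma m_nonzero [simp]: "m x \<noteq> 0"
  using m_pos[of x] by linarith

lemma infsum_weight: "(\<Sum>\<^sub>\<infinity>y. w x y * g y) = (\<Sum>y\<in>nbrs x. w x y * g y)"
proof -
  have "w x y = 0" if "y \<notin> nbrs x" for y
    using that w_nonneg[of x y] by (simp add: nbrs_def)
  then have "(\<Sum>\<^sub>\<infinity>y. w x y * g y) = (\<Sum>\<^sub>\<infinity>y\<in>nbrs x. w x y * g y)"
    by (intro infsum_cong_neutral) auto
  then show ?thesis by simp
qed

lemma laplacian_eq_sum:
  "laplacian w m f x = (\<Sum>y\<in>nbrs x. w x y * (f y - f x)) / m x"
  by (simp add: laplacian_def infsum_weight)

lemma Deg_eq_sum: "Deg w m x = (\<Sum>y\<in>nbrs x. w x y) / m x"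
  using infsum_weight[of x "\<lambda>_. 1"] by (simp add: Deg_def)

lemma Deg_nonneg: "Deg w m x \<ge> 0"
  by (simp add: Deg_eq_sum sum_nonneg less_imp_le)

text \<open>Termwise product rule; in this form bilinearity and positivity of \<open>Gamma\<close>
  are visible.\<close>

lemma Gamma_eq_sum:
  "Gamma w m f g x = (\<Sum>y\<in>nbrs x. w x y * ((f y - f x) * (g y - g x))) / (2 * m x)"
proof -
  have "(\<Sum>y\<in>nbrs x. w x y * ((f y - f x) * (g y - g x))) =
      (\<Sum>y\<in>nbrs x. w x y * (f y * g y - f x * g x))
      - f x * (\<Sum>y\<in>nbrs x. w x y * (g y - g x)) - g x * (\<Sum>y\<in>nbrs x. w x y * (f y - f x))"
    by (simp add: sum_distrib_left sum_subtractf[symmetric] algebra_simps)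
  then show ?thesis
    by (simp add: Gamma_def laplacian_eq_sum diff_divide_distrib)
qed

lemma Gamma_add_scaled:
  "Gamma w m (\<lambda>z. f z + a * g z) (\<lambda>z. f z + a * g z) x =
     Gamma w m f f x + 2 * a * Gamma w m f g x + a\<^sup>2 * Gamma w m g g x"
proof -
  have "(\<Sum>y\<in>nbrs x. w x y * (((f y + a * g y) - (f x + a * g x)) * ((f y + a * g y) - (f x + a * g x)))) =
      (\<Sum>y\<in>nbrs x. w x y * ((f y - f x) * (f y - f x)))
      + 2 * a * (\<Sum>y\<in>nbrs x. w x y * ((f y - f x) * (g y - g x)))
      + a\<^sup>2 * (\<Sum>y\<in>nbrs x. w x y * ((g y - g x) * (g y - g x)))"
    by (simp add: sum_distrib_left sum.distrib[symmetric] algebra_simps power2_eq_square)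
  then show ?thesis
    by (simp add: Gamma_eq_sum add_divide_distrib)
qed

lemma Gamma_nonneg: "Gamma w m f f x \<ge> 0"
  by (simp add: Gamma_eq_sum sum_nonneg less_imp_le)

text \<open>A single term of a sum of nonnegative terms. This later turns decay of
  \<open>Gamma\<close> into decay of differences along edges.\<close>

lemma edge_diff_le_Gamma: "w x y * (f y - f x)\<^sup>2 \<le> 2 * m x * Gamma w m f f x"
proof -
  have "w x y * (f y - f x)\<^sup>2 \<le> (\<Sum>z\<in>nbrs x. w x z * (f z - f x)\<^sup>2)"
  proof (cases "y \<in> nbrs x")
    case True
    then show ?thesis
      by (intro member_le_sum[where f = "\<lambda>z. w x z * (f z - f x)\<^sup>2"]) auto
  next
    case False
    then have "w x y = 0"
      using w_nonneg[of x y] by (simp add: nbrs_def)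
    then show ?thesis by (simp add: sum_nonneg)
  qed
  then show ?thesis
    by (simp add: Gamma_eq_sum power2_eq_square)
qed

text \<open>Cauchy-Schwarz after splitting each weight as
  \<open>sqrt (w x y) * sqrt (w x y)\<close>. Keeping the local degree here, not a uniform bound, is
  what puts \<open>Deg\<close> at the two end points into the final estimate.\<close>

lemma laplacian_sq_le: "(laplacian w m f x)\<^sup>2 \<le> 2 * Deg w m x * Gamma w m f f x"
proof -
  have "(\<Sum>y\<in>nbrs x. w x y * (f y - f x))\<^sup>2 =
      (\<Sum>y\<in>nbrs x. sqrt (w x y) * (sqrt (w x y) * (f y - f x)))\<^sup>2"
    by (simp flip: mult.assoc)
  also have "\<dots> \<le> (\<Sum>y\<in>nbrs x. (sqrt (w x y))\<^sup>2) * (\<Sum>y\<in>nbrs x. (sqrt (w x y) * (f y - f x))\<^sup>2)"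
    by (rule Cauchy_Schwarz_ineq_sum)
  also have "\<dots> = (\<Sum>y\<in>nbrs x. w x y) * (\<Sum>y\<in>nbrs x. w x y * ((f y - f x) * (f y - f x)))"
    by (simp add: power_mult_distrib power2_eq_square[of "f _ - f _"])
  finally show ?thesis
    by (simp add: laplacian_eq_sum Deg_eq_sum Gamma_eq_sum power_divide power2_eq_square[of "m x"]
        divide_right_mono)
qed

text \<open>Substitute for the maximum principle: on an infinite graph a bounded function need not
  attain its supremum, so the gap \<open>c - g x\<close> is kept.\<close>

lemma laplacian_le:
  assumes "\<And>y. g y \<le> c"
  shows "laplacian w m g x \<le> Deg w m x * (c - g x)"
proof -
  have "(\<Sum>y\<in>nbrs x. w x y * (g y - g x)) \<le> (\<Sum>y\<in>nbrs x. w x y * (c - g x))"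
    using assms by (intro sum_mono mult_left_mono) auto
  then show ?thesis
    by (simp add: laplacian_eq_sum Deg_eq_sum divide_right_mono less_imp_le flip: sum_distrib_right)
qed

text \<open>Each squared difference is at most \<open>4 * B\<close>, by
  \<open>(a - b)\<^sup>2 \<le> 2 * a\<^sup>2 + 2 * b\<^sup>2\<close>.\<close>

lemma Gamma_le_of_sq_le:
  assumes "\<And>y. (g y)\<^sup>2 \<le> B"
  shows "Gamma w m g g x \<le> 2 * Deg w m x * B"
proof -
  have "(g y - g x) * (g y - g x) \<le> 4 * B" for y
    using assms[of x] assms[of y] sum_squares_bound[of "g y" "- g x"]
    by (simp add: power2_eq_square algebra_simps)
  then have "(\<Sum>y\<in>nbrs x. w x y * ((g y - g x) * (g y - g x))) \<le> (\<Sum>y\<in>nbrs x. w x y * (4 * B))"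
    by (intro sum_mono mult_left_mono) auto
  then have "Gamma w m g g x \<le> (\<Sum>y\<in>nbrs x. w x y * (4 * B)) / (2 * m x)"
    by (simp add: Gamma_eq_sum divide_right_mono less_imp_le)
  also have "\<dots> = 2 * Deg w m x * B"
    by (simp add: Deg_eq_sum flip: sum_distrib_right)
  finally show ?thesis .
qed

end

section \<open>Contraction of the gradient under one Euler step\<close>

locale CD_graph = locally_finite_graph w m
  for w :: "'v::countable \<Rightarrow> 'v \<Rightarrow> real" and m :: "'v \<Rightarrow> real" +
  fixes K D :: real
  assumes connected: "connected_graph w"
    and CD: "CD_infinity w m K"
    and Deg_le: "\<And>x. Deg w m x \<le> D"
begin

lemma D_nonneg: "D \<ge> 0"
  using Deg_nonneg Deg_le order_trans by blast

definition euler :: "real \<Rightarrow> ('v \<Rightarrow> real) \<Rightarrow> 'v \<Rightarrow> real" where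
  "euler e f = (\<lambda>x. f x + e * laplacian w m f x)"

lemma Gamma_laplacian_le:
  assumes "\<And>y. Gamma w m f f y \<le> c"
  shows "Gamma w m (laplacian w m f) (laplacian w m f) x \<le> 4 * D\<^sup>2 * c"
proof -
  have c: "c \<ge> 0"
    using Gamma_nonneg assms order_trans by blast
  have "(laplacian w m f y)\<^sup>2 \<le> 2 * D * c" for y
  proof -
    have "Deg w m y * Gamma w m f f y \<le> D * c"
      using Deg_le assms D_nonneg Gamma_nonneg by (intro mult_mono) auto
    then show ?thesis
      using laplacian_sq_le[of f y] by simp
  qed
  then have "Gamma w m (laplacian w m f) (laplacian w m f) x \<le> 2 * Deg w m x * (2 * D * c)"
    by (rule Gamma_le_of_sq_le)
  also have "\<dots> \<le> 2 * D * (2 * D * c)"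
    using Deg_le D_nonneg c by (intro mult_right_mono) auto
  finally show ?thesis
    by (simp add: power2_eq_square)
qed

text \<open>Expand \<open>Gamma\<close> of the Euler step in powers of \<open>e\<close>: the
  curvature bound controls the linear term, boundedness of the Laplacian the quadratic one. The
  factor is written as a square so that square roots of \<open>Gamma\<close> contract
  geometrically.\<close>

lemma Gamma_euler_le:
  assumes e: "e > 0" "e * (D + 2 * K) \<le> 1"
    and c: "\<And>y. Gamma w m f f y \<le> c"
  shows "Gamma w m (euler e f) (euler e f) x \<le> (1 - e * (K - 2 * D\<^sup>2 * e))\<^sup>2 * c"
proof -
  define G where "G = Gamma w m f f x"
  have c0: "c \<ge> 0"
    using Gamma_nonneg c order_trans by blast
  have "laplacian w m (Gamma w m f f) x - 2 * Gamma w m f (laplacian w m f) x \<ge> 2 * K * G"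
    using CD by (simp add: CD_infinity_def Gamma2_def G_def algebra_simps)
  moreover have "laplacian w m (Gamma w m f f) x \<le> D * (c - G)"
  proof -
    have "Deg w m x * (c - G) \<le> D * (c - G)"
      using Deg_le c by (intro mult_right_mono) (auto simp: G_def)
    then show ?thesis
      using laplacian_le[of "Gamma w m f f" c x] c by (simp add: G_def)
  qed
  ultimately have "2 * Gamma w m f (laplacian w m f) x \<le> D * (c - G) - 2 * K * G"
    by linarith
  then have 1: "e * (2 * Gamma w m f (laplacian w m f) x) \<le> e * (D * (c - G) - 2 * K * G)"
    using e by (intro mult_left_mono) auto
  have 2: "e\<^sup>2 * Gamma w m (laplacian w m f) (laplacian w m f) x \<le> e\<^sup>2 * (4 * D\<^sup>2 * c)"
    using Gamma_laplacian_le[OF c] by (intro mult_left_mono) auto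
  have "Gamma w m (euler e f) (euler e f) x \<le> G + e * (D * (c - G) - 2 * K * G) + e\<^sup>2 * (4 * D\<^sup>2 * c)"
    using 1 2 by (simp add: euler_def Gamma_add_scaled G_def)
  also have "\<dots> = (1 - e * (D + 2 * K)) * G + e * D * c + e\<^sup>2 * (4 * D\<^sup>2 * c)"
    by (simp add: algebra_simps)
  \<comment> \<open>The step size condition makes the coefficient of \<open>G\<close> nonnegative,
    so \<open>G\<close> may be replaced by \<open>c\<close>; the terms \<open>e * D * c\<close> then
    cancel.\<close>
  also have "\<dots> \<le> (1 - e * (D + 2 * K)) * c + e * D * c + e\<^sup>2 * (4 * D\<^sup>2 * c)"
    using e c[of x] by (simp add: G_def mult_left_mono)
  \<comment> \<open>With \<open>q = K - 2 * D\<^sup>2 * e\<close> the total factor is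
    \<open>1 - 2 * e * q\<close>, and the square is completed.\<close>
  also have "\<dots> = (1 - e * (K - 2 * D\<^sup>2 * e))\<^sup>2 * c - (e * (K - 2 * D\<^sup>2 * e))\<^sup>2 * c"
    by (simp add: algebra_simps power2_eq_square)
  also have "\<dots> \<le> (1 - e * (K - 2 * D\<^sup>2 * e))\<^sup>2 * c"
    using c0 by simp
  finally show ?thesis .
qed

section \<open>Iterating the Euler step with a fixed step size\<close>

context
  fixes f :: "'v \<Rightarrow> real" and e r :: real
  assumes e: "e > 0" "e * (D + 2 * K) \<le> 1"
    and r: "r = 1 - e * (K - 2 * D\<^sup>2 * e)" "0 \<le> r" "r < 1"
    and Gamma_le_1: "\<And>y. Gamma w m f f y \<le> 1"
begin

lemma Gamma_euler_iterate_le: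
  "Gamma w m ((euler e ^^ n) f) ((euler e ^^ n) f) x \<le> (r ^ n)\<^sup>2"
proof (induction n arbitrary: x)
  case 0
  then show ?case using Gamma_le_1 by simp
next
  case (Suc n)
  then show ?case
    using Gamma_euler_le[OF e, of "(euler e ^^ n) f" "(r ^ n)\<^sup>2" x] by (simp add: r(1) power_mult_distrib)
qed

text \<open>Step \<open>n\<close> moves the value at \<open>x\<close> by \<open>e\<close> times the
  Laplacian, hence by at most \<open>e * S * r ^ n\<close>; these moves are summed.\<close>

lemma euler_iterate_displacement:
  "\<bar>(euler e ^^ n) f x - f x\<bar> \<le> sqrt (2 * Deg w m x) / (K - 2 * D\<^sup>2 * e)"
proof -
  define S where "S = sqrt (2 * Deg w m x)"
  have S0: "S \<ge> 0"
    by (simp add: S_def Deg_nonneg)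
  define q where "q = K - 2 * D\<^sup>2 * e"
  have q: "r = 1 - e * q" "e * q > 0"
    using r by (simp_all add: q_def)
  have "\<bar>(euler e ^^ n) f x - f x\<bar> \<le> e * S * (\<Sum>k<n. r ^ k)"
  proof (induction n)
    case (Suc n)
    let ?g = "(euler e ^^ n) f"
    have "(laplacian w m ?g x)\<^sup>2 \<le> (S * r ^ n)\<^sup>2"
    proof -
      have "(laplacian w m ?g x)\<^sup>2 \<le> 2 * Deg w m x * Gamma w m ?g ?g x"
        by (rule laplacian_sq_le)
      also have "\<dots> \<le> 2 * Deg w m x * (r ^ n)\<^sup>2"
        using Gamma_euler_iterate_le by (intro mult_left_mono) (auto simp: Deg_nonneg)
      finally show ?thesis
        by (simp add: S_def power_mult_distrib Deg_nonneg)
    qed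
    then have "\<bar>laplacian w m ?g x\<bar> \<le> S * r ^ n"
      using S0 r(2) abs_le_square_iff[of "laplacian w m ?g x" "S * r ^ n"] by simp
    then have "\<bar>e * laplacian w m ?g x\<bar> \<le> e * (S * r ^ n)"
      using e by (simp add: abs_mult)
    moreover have "(euler e ^^ Suc n) f x = ?g x + e * laplacian w m ?g x"
      by (simp add: euler_def)
    ultimately show ?case
      using Suc by (simp add: algebra_simps)
  qed simp
  \<comment> \<open>Since \<open>1 - r = e * q\<close>, the geometric sum costs a factor
    \<open>1 / e\<close>, which cancels the step size and leaves a bound independent of
    \<open>n\<close>.\<close>
  also have "\<dots> \<le> e * S * (1 / (e * q))"
  proof -
    have "(\<Sum>k<n. r ^ k) = (1 - r ^ n) / (e * q)"
      using q(1) r(3) by (subst sum_gp_strict) auto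
    also have "\<dots> \<le> 1 / (e * q)"
      using q r(2) by (intro divide_right_mono) auto
    finally show ?thesis
      using e S0 by (intro mult_left_mono) auto
  qed
  also have "\<dots> = S / q"
    using e by simp
  finally show ?thesis
    by (simp add: S_def q_def)
qed

text \<open>The constant \<open>?C\<close> depends on the edge, so the convergence is only edgewise;
  this suffices because two vertices are joined by a finite path.\<close>

lemma euler_iterate_edge_tendsto:
  assumes "w x y > 0"
  shows "(\<lambda>n. (euler e ^^ n) f y - (euler e ^^ n) f x) \<longlonglongrightarrow> 0"
proof (rule Lim_null_comparison)
  let ?C = "sqrt (2 * m x / w x y)"
  show "(\<lambda>n. ?C * r ^ n) \<longlonglongrightarrow> 0"
    using r by (intro tendsto_mult_right_zero LIMSEQ_power_zero) auto
  have "\<bar>(euler e ^^ n) f y - (euler e ^^ n) f x\<bar> \<le> ?C * r ^ n" for n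
  proof -
    let ?g = "(euler e ^^ n) f"
    have "w x y * (?g y - ?g x)\<^sup>2 \<le> 2 * m x * Gamma w m ?g ?g x"
      by (rule edge_diff_le_Gamma)
    also have "\<dots> \<le> 2 * m x * (r ^ n)\<^sup>2"
      using Gamma_euler_iterate_le by (intro mult_left_mono) (auto simp: less_imp_le)
    finally have "(?g y - ?g x)\<^sup>2 \<le> 2 * m x / w x y * (r ^ n)\<^sup>2"
      using assms by (simp add: field_simps)
    also have "\<dots> = (?C * r ^ n)\<^sup>2"
      using assms by (simp add: power_mult_distrib less_imp_le)
    finally show ?thesis
      using r(2) assms abs_le_square_iff[of "?g y - ?g x" "?C * r ^ n"] by (simp add: less_imp_le)
  qed
  then show "\<forall>\<^sub>F n in sequentially. norm ((euler e ^^ n) f y - (euler e ^^ n) f x) \<le> ?C * r ^ n"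
    by simp
qed

lemma euler_iterate_diff_tendsto:
  "(\<lambda>n. (euler e ^^ n) f y - (euler e ^^ n) f x) \<longlonglongrightarrow> 0"
proof -
  have "(\<lambda>a b. w a b > 0)\<^sup>*\<^sup>* x y"
    using connected by (simp add: connected_graph_def)
  then show ?thesis
  proof induction
    case (step y z)
    then show ?case
      using tendsto_add[OF step.IH euler_iterate_edge_tendsto[of y z]] by simp
  qed simp
qed

text \<open>Compare \<open>f\<close> with its iterates at both end points and let the difference of
  the iterates tend to 0.\<close>

lemma diff_le_approx:
  "f y - f x \<le> (sqrt (2 * Deg w m x) + sqrt (2 * Deg w m y)) / (K - 2 * D\<^sup>2 * e)"
proof -
  have "f y - f x - (sqrt (2 * Deg w m x) + sqrt (2 * Deg w m y)) / (K - 2 * D\<^sup>2 * e)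
      \<le> (euler e ^^ n) f y - (euler e ^^ n) f x" for n
    using euler_iterate_displacement[of n x] euler_iterate_displacement[of n y]
    unfolding add_divide_distrib abs_le_iff by linarith
  then show ?thesis
    using tendsto_lowerbound[OF euler_iterate_diff_tendsto always_eventually]
    by (metis diff_le_0_iff_le trivial_limit_sequentially)
qed

end

text \<open>The number of iterations has already gone to infinity for each fixed \<open>e\<close>;
  now the step size goes to 0 and the discretization loss \<open>2 * D\<^sup>2 * e\<close>
  disappears.\<close>

lemma diff_le:
  assumes K: "K > 0" and f: "\<And>y. Gamma w m f f y \<le> 1"
  shows "f y - f x \<le> (sqrt (2 * Deg w m x) + sqrt (2 * Deg w m y)) / K"
proof (rule tendsto_lowerbound)
  let ?S = "sqrt (2 * Deg w m x) + sqrt (2 * Deg w m y)"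
  have "((\<lambda>e. ?S / (K - 2 * D\<^sup>2 * e)) \<longlongrightarrow> ?S / (K - 2 * D\<^sup>2 * 0)) (at_right 0)"
    using K by (intro tendsto_intros) auto
  then show "((\<lambda>e. ?S / (K - 2 * D\<^sup>2 * e)) \<longlongrightarrow> ?S / K) (at_right 0)"
    by simp
  have lim1: "((\<lambda>e. e * (D + 2 * K)) \<longlongrightarrow> 0 * (D + 2 * K)) (at_right 0)"
    by (intro tendsto_intros)
  have lim2: "((\<lambda>e. K - 2 * D\<^sup>2 * e) \<longlongrightarrow> K - 2 * D\<^sup>2 * 0) (at_right 0)"
    by (intro tendsto_intros)
  have lim3: "((\<lambda>e. e * (K - 2 * D\<^sup>2 * e)) \<longlongrightarrow> 0 * (K - 2 * D\<^sup>2 * 0)) (at_right 0)"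
    by (intro tendsto_intros)
  \<comment> \<open>Admissibility of small step sizes. With
    \<open>r = 1 - e * (K - 2 * D\<^sup>2 * e)\<close>, the last of the four bounds gives
    \<open>0 \<le> r\<close>, and the first and third give \<open>r < 1\<close>.\<close>
  have "\<forall>\<^sub>F e in at_right 0. (0::real) < e"
    by (rule eventually_at_right_less)
  moreover have "\<forall>\<^sub>F e in at_right 0. e * (D + 2 * K) < 1"
    using order_tendstoD(2)[OF lim1] by simp
  moreover have "\<forall>\<^sub>F e in at_right 0. K - 2 * D\<^sup>2 * e > 0"
    using order_tendstoD(1)[OF lim2, of 0] K by simp
  moreover have "\<forall>\<^sub>F e in at_right 0. e * (K - 2 * D\<^sup>2 * e) < 1"
    using order_tendstoD(2)[OF lim3] by simp
  ultimately show "\<forall>\<^sub>F e in at_right 0. f y - f x \<le> ?S / (K - 2 * D\<^sup>2 * e)"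
  proof eventually_elim
    case (elim e)
    then show ?case
      by (intro diff_le_approx[OF _ _ refl]) (auto simp: f)
  qed
qed simp

end

theorem theorem2p1:
  fixes w :: "'v::countable \<Rightarrow> 'v \<Rightarrow> real" and m :: "'v \<Rightarrow> real" and K :: real
    and x\<^sub>0 y\<^sub>0 :: 'v
  assumes "weighted_graph w m"
    and "connected_graph w"
    and "locally_finite w"
    and "K > 0"
    and "CD_infinity w m K"
    and "Deg_max w m < \<infinity>"
  shows "resistance_metric w m x\<^sub>0 y\<^sub>0
           \<le> ereal ((sqrt (2 * Deg w m x\<^sub>0) + sqrt (2 * Deg w m y\<^sub>0)) / K)"
proof -
  \<comment> \<open>An inequality instead of an equation also covers the formal value
    \<open>- \<infinity>\<close> in the case split.\<close>
  obtain D where D: "Deg_max w m \<le> ereal D"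
    using assms(6) by (cases "Deg_max w m") auto
  have "Deg w m x \<le> D" for x
    using order_trans[OF SUP_upper[of x UNIV "\<lambda>x. ereal (Deg w m x)"] D[unfolded Deg_max_def]] by simp
  then interpret CD_graph w m K D
    using assms by unfold_locales
  show ?thesis
    unfolding resistance_metric_def
  proof (rule SUP_least)
    fix f
    assume "f \<in> {f. sup_norm (Gamma w m f f) \<le> 1}"
    then have *: "sup_norm (Gamma w m f f) \<le> 1" by simp
    have "Gamma w m f f x \<le> 1" for x
      using order_trans[OF SUP_upper[of x UNIV "\<lambda>x. ereal \<bar>Gamma w m f f x\<bar>"] *[unfolded sup_norm_def]]
      by simp
    then show "ereal (f y\<^sub>0 - f x\<^sub>0) \<le> ereal ((sqrt (2 * Deg w m x\<^sub>0) + sqrt (2 * Deg w m y\<^sub>0)) / K)"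
      using diff_le[OF assms(4)] by simp
  qed
qed

end
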